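(* Let $K$ be a field and let $S$ be a $K$-algebra with a pseudo-degree function $\chi$. If $a \in S$ satisfies $\chi(a) = m > 0$ and the centralizer $C_S(a)$ satisfies condition $D(1)$ (with respect to $\chi$), then: (1) $C_S(a)$ has a finite basis as a $K[a]$-module, the cardinality of which divides $m$; (2) $C_S(a)$ is a commutative algebra.
   Context: All rings and algebras are associative and unital. For a ring $S$ and $a \in S$, the centralizer $C_S(a)$ is the set of all elements of $S$ that commute with $a$. $K[a]$ denotes the subalgebra of $S$ consisting of all polynomials in $a$ with coefficients in $K$; it acts on $C_S(a)$ by multiplication. Pseudo-degree function: for a $K$-algebra $S$, a function $\chi : S \to \mathbb{Z} \cup \{-\infty\}$ is called a pseudo-degree function if (i) $\chi(a) = -\infty$ if and only if $a = 0$; (ii) $\chi(ab) = \chi(a) + \chi(b)$ for all $a,b \in S$; (iii) $\chi(a+b) \leq \max(\chi(a),\chi(b))$ for all $a,b \in S$. Condition $D(\ell)$: let $S$ be a $K$-algebra with pseudo-degree function $\chi$ and let $\ell$ be a positive integer. A subalgebra $B \subset S$ satisfies condition $D(\ell)$ if $\chi(b) \geq 0$ for all non-zero $b \in B$ and if, whenever $b_1, \ldots, b_{\ell+1} \in B$ are $\ell+1$ elements all mapped to the same integer by $\chi$ (in particular they are all non-zero), there exist $\alpha_1, \ldots, \alpha_{\ell+1} \in K$, not all zero, such that $\chi\left(\sum_{i=1}^{\ell+1} \alpha_i b_i\right) < \chi(b_1)$. Condition $D(1)$ is the case $\ell = 1$. *)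

theory Defs
  imports
    Complex_Main
    "HOL-Library.Extended"
    "HOL-Computational_Algebra.Polynomial"
begin

text \<open>Associative unital algebras over a field, not necessarily commutative. The class
  \<open>ring_1\<close> demands \<open>0 \<noteq> 1\<close>, so the zero algebra is excluded.\<close>

locale assoc_algebra = vector_space scale
  for scale :: "'k::field \<Rightarrow> 's::ring_1 \<Rightarrow> 's" (infixr \<open>*s\<close> 75) +
  assumes scale_mult_left: "(c *s x) * y = c *s (x * y)"
    and scale_mult_right: "x * (c *s y) = c *s (x * y)"

definition subalgebra :: "('k::field \<Rightarrow> 's::ring_1 \<Rightarrow> 's) \<Rightarrow> 's set \<Rightarrow> bool" where
  "subalgebra scale B \<longleftrightarrow>
     1 \<in> B \<and> (\<forall>x\<in>B. \<forall>y\<in>B. x + y \<in> B \<and> x * y \<in> B) \<and> (\<forall>c. \<forall>x\<in>B. scale c x \<in> B)"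

definition centralizer :: "'s::ring_1 \<Rightarrow> 's set" where
  "centralizer a = {x. x * a = a * x}"

text \<open>The library function \<open>poly\<close> needs a commutative ring and has coefficients and argument
  of the same type, hence a separate evaluation.\<close>

definition alg_eval :: "('k::field \<Rightarrow> 's::ring_1 \<Rightarrow> 's) \<Rightarrow> 'k poly \<Rightarrow> 's \<Rightarrow> 's" where
  "alg_eval scale p a = (\<Sum>i\<le>degree p. scale (coeff p i) (a ^ i))"

definition poly_subalgebra :: "('k::field \<Rightarrow> 's::ring_1 \<Rightarrow> 's) \<Rightarrow> 's \<Rightarrow> 's set" where
  "poly_subalgebra scale a = range (\<lambda>p. alg_eval scale p a)"

text \<open>The target \<open>int extended\<close> also has the value \<open>Pinf\<close>, which is ruled out; what remains is
  \<open>\<int> \<union> {-\<infinity>}\<close> with its usual order and addition.\<close>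

definition pseudo_degree :: "('s::ring_1 \<Rightarrow> int extended) \<Rightarrow> bool" where
  "pseudo_degree \<chi> \<longleftrightarrow>
     (\<forall>a. \<chi> a \<noteq> Pinf) \<and>
     (\<forall>a. \<chi> a = Minf \<longleftrightarrow> a = 0) \<and>
     (\<forall>a b. \<chi> (a * b) = \<chi> a + \<chi> b) \<and>
     (\<forall>a b. \<chi> (a + b) \<le> max (\<chi> a) (\<chi> b))"

definition condition_D ::
    "nat \<Rightarrow> ('k::field \<Rightarrow> 's::ring_1 \<Rightarrow> 's) \<Rightarrow> ('s \<Rightarrow> int extended) \<Rightarrow> 's set \<Rightarrow> bool" where
  "condition_D l scale \<chi> B \<longleftrightarrow>
     l > 0 \<and> subalgebra scale B \<and>
     (\<forall>b\<in>B. b \<noteq> 0 \<longrightarrow> \<chi> b \<ge> Fin 0) \<and>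
     (\<forall>(b :: nat \<Rightarrow> 's) (n :: int).
        (\<forall>i\<in>{1..l+1}. b i \<in> B \<and> \<chi> (b i) = Fin n) \<longrightarrow>
        (\<exists>\<alpha> :: nat \<Rightarrow> 'k. (\<exists>i\<in>{1..l+1}. \<alpha> i \<noteq> 0) \<and>
           \<chi> (\<Sum>i=1..l+1. scale (\<alpha> i) (b i)) < \<chi> (b 1)))"

text \<open>\<open>E\<close> is a finite basis of \<open>M\<close> as a left module over the subring \<open>R\<close> of the ambient ring,
  which acts by multiplication. The library's \<open>module\<close> locale does not apply, as its scalars
  form a type.\<close>

definition finite_module_basis :: "'s::ring_1 set \<Rightarrow> 's set \<Rightarrow> 's set \<Rightarrow> bool" where
  "finite_module_basis R M E \<longleftrightarrow>
     finite E \<and> E \<subseteq> M \<and>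
     (\<forall>x\<in>M. \<exists>r. (\<forall>e\<in>E. r e \<in> R) \<and> x = (\<Sum>e\<in>E. r e * e)) \<and>
     (\<forall>r. (\<forall>e\<in>E. r e \<in> R) \<and> (\<Sum>e\<in>E. r e * e) = 0 \<longrightarrow> (\<forall>e\<in>E. r e = 0))"

lemma (in assoc_algebra) subalgebra_centralizer: "subalgebra scale (centralizer a)"
proof -
  have "x * y * a = a * (x * y)" if "x * a = a * x" "y * a = a * y" for x y
    by (metis that mult.assoc)
  then show ?thesis
    by (auto simp: subalgebra_def centralizer_def scale_mult_left scale_mult_right algebra_simps)
qed

lemma (in assoc_algebra) poly_subalgebra_mult_centralizer:
  assumes "r \<in> poly_subalgebra scale a" "x \<in> centralizer a"
  shows "r * x \<in> centralizer a"
proof -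
  obtain p where r: "r = alg_eval scale p a"
    using assms(1) by (auto simp: poly_subalgebra_def)
  have "r * a = a * r"
    by (simp add: r alg_eval_def sum_distrib_left sum_distrib_right
        scale_mult_left scale_mult_right power_commutes)
  then show ?thesis
    using assms(2) by (simp add: centralizer_def) (metis mult.assoc)
qed

end

theory Submission
  imports Defs "HOL-Number_Theory.Cong"
begin

text \<open>Let \<open>D\<close> be the set of degrees of the nonzero elements of \<open>C = C\<^sub>S(a)\<close>. Its reduction modulo
  \<open>m\<close> is a submonoid, hence a subgroup, of \<open>\<int>/m\<close>, so it is cyclic of an order dividing \<open>m\<close>.
  Choosing an element of minimal degree in each class gives the basis: condition \<open>D(1)\<close> lets one
  cancel leading terms, and terms of distinct degrees cannot add up to \<open>0\<close>.

  For commutativity, let \<open>b \<in> C\<close> have a degree that generates the subgroup. If \<open>y\<close> commutes with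
  \<open>b\<close>, then it commutes with all \<open>a\<^sup>i b\<^sup>j\<close>, so cancelling leading terms shows that every element
  of \<open>C\<close> agrees, up to an element commuting with \<open>y\<close>, with one whose degree is less than a constant
  \<open>N\<close>. Apply this to \<open>a\<^sup>j x\<close>: the degree of \<open>a\<^sup>j [x, y] = [a\<^sup>j x, y]\<close> is bounded independently of
  \<open>j\<close>, which forces \<open>[x, y] = 0\<close>. Taking \<open>y = b\<close> shows that \<open>b\<close> is central in \<open>C\<close>, and then \<open>y\<close>
  may be arbitrary.\<close>

section \<open>Additively closed sets of natural numbers modulo \<open>m\<close>\<close>

text \<open>Take for \<open>g\<close> the least positive number congruent modulo \<open>m\<close> to
  an element of \<open>D\<close>. Division with remainder by \<open>g\<close> then works as in a
  subgroup of the integers: a nonzero remainder would be a smaller number of this kind.\<close>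

lemma additive_nat_set_generator:
  fixes D :: "nat set" and m :: nat
  assumes add: "\<And>x y. x \<in> D \<Longrightarrow> y \<in> D \<Longrightarrow> x + y \<in> D" and m: "m \<in> D" "m > 0"
  obtains g b where "b \<in> D" "[b = g] (mod m)" "g dvd m" "\<And>x. x \<in> D \<Longrightarrow> g dvd x"
proof -
  define P where "P g \<longleftrightarrow> g > 0 \<and> (\<exists>b\<in>D. [b = g] (mod m))" for g
  define g where "g = (LEAST g. P g)"
  have Pm: "P m"
    using m by (auto simp: P_def intro: bexI[of _ m])
  have Pg: "P g"
    unfolding g_def by (rule LeastI) (rule Pm)
  then obtain b where g: "g > 0" and b: "b \<in> D" "[b = g] (mod m)"
    by (auto simp: P_def)
  have mult: "x + k * b \<in> D" if "x \<in> D" for x k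
  proof (induction k)
    case (Suc k)
    then show ?case
      using add[OF Suc b(1)] by (simp add: algebra_simps)
  qed (use that in simp)
  have dvd: "g dvd x" if x: "x \<in> D" for x
  proof -
    define q where "q = x div g"
    have xq: "x = q * g + x mod g"
      by (simp add: q_def)
    \<comment> \<open>\<open>D\<close> need not be closed under subtraction, but modulo
      \<open>m\<close> adding \<open>(m - 1) * q\<close> copies of \<open>b\<close> subtracts
      \<open>q * g\<close>.\<close>
    have "[x + ((m - 1) * q) * b = x + ((m - 1) * q) * g] (mod m)"
      using b(2) by (intro cong_add cong_mult) auto
    also have "x + ((m - 1) * q) * g = x mod g + m * (q * g)"
    proof -
      have "x + ((m - 1) * q) * g = x mod g + (q * g + (m - 1) * (q * g))"
        by (subst (1) xq) (simp add: algebra_simps)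
      also have "q * g + (m - 1) * (q * g) = m * (q * g)"
        using m(2) by (cases m) auto
      finally show ?thesis .
    qed
    also have "[x mod g + m * (q * g) = x mod g] (mod m)"
      by (simp add: cong_def)
    finally have "[x + ((m - 1) * q) * b = x mod g] (mod m)" .
    then have "x mod g > 0 \<Longrightarrow> P (x mod g)"
      using mult[OF x] by (auto simp: P_def)
    moreover have "\<not> P (x mod g)"
      unfolding g_def by (rule not_less_Least) (use g g_def in auto)
    ultimately show ?thesis
      by (auto simp: dvd_eq_mod_eq_0)
  qed
  show thesis
    using that b dvd m(1) by blast
qed

text \<open>The residues are exactly the multiples of \<open>g\<close> below \<open>m\<close>, so
  there are \<open>m div g\<close> of them. Since \<open>b\<close> is congruent to \<open>g\<close>,
  multiples of \<open>b\<close> represent all of them.\<close>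

lemma additive_nat_set_residues:
  fixes D :: "nat set" and m :: nat
  assumes add: "\<And>x y. x \<in> D \<Longrightarrow> y \<in> D \<Longrightarrow> x + y \<in> D" and m: "m \<in> D" "m > 0"
  shows "card ((\<lambda>n. n mod m) ` D) dvd m"
    and "\<exists>b\<in>D. \<forall>n\<in>D. \<exists>k<m. [n = k * b] (mod m)"
proof -
  obtain g b where b: "b \<in> D" "[b = g] (mod m)" and g: "g dvd m" "\<And>x. x \<in> D \<Longrightarrow> g dvd x"
    using additive_nat_set_generator[OF add m] by metis
  have g0: "g > 0"
    using g(1) m(2) by (auto intro: Nat.gr0I)
  \<comment> \<open>The summand \<open>m\<close> leaves the residue unchanged and covers
    \<open>k = 0\<close>, as \<open>0\<close> is not assumed to lie in \<open>D\<close>.\<close>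
  have mult: "m + k * b \<in> D" for k
  proof (induction k)
    case (Suc k)
    then show ?case
      using add[OF Suc b(1)] by (simp add: algebra_simps)
  qed (use m in simp)
  have "(\<lambda>n. n mod m) ` D = (\<lambda>k. k * g) ` {..<m div g}"
  proof (intro equalityI subsetI)
    fix h assume "h \<in> (\<lambda>n. n mod m) ` D"
    then obtain n where n: "n \<in> D" "h = n mod m"
      by auto
    then have "g dvd h"
      using g by (simp add: dvd_mod)
    then obtain k where k: "h = k * g"
      by (metis dvd_def mult.commute)
    have "k * g < (m div g) * g"
      using n m g k by simp
    then show "h \<in> (\<lambda>k. k * g) ` {..<m div g}"
      using k by auto
  next
    fix h assume "h \<in> (\<lambda>k. k * g) ` {..<m div g}"
    then obtain k where k: "k < m div g" "h = k * g"
      by auto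
    have "k * g < (m div g) * g"
      using k g0 by simp
    then have "h < m"
      using k g by simp
    moreover have "[m + k * b = 0 + k * g] (mod m)"
      using b by (intro cong_add cong_mult) (auto simp: cong_def)
    ultimately have "(m + k * b) mod m = h"
      using k by (simp add: cong_def)
    then show "h \<in> (\<lambda>n. n mod m) ` D"
      using mult by (metis image_eqI)
  qed
  moreover have "inj_on (\<lambda>k. k * g) {..<m div g}"
    using g0 by (auto simp: inj_on_def)
  ultimately have "card ((\<lambda>n. n mod m) ` D) = m div g"
    by (simp add: card_image)
  then show "card ((\<lambda>n. n mod m) ` D) dvd m"
    using g(1) by (metis dvd_mult_div_cancel dvd_triv_right)
  have "\<exists>k<m. [n = k * b] (mod m)" if n: "n \<in> D" for n
  proof -
    obtain l where l: "n = l * g"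
      using g(2)[OF n] by (metis dvd_def mult.commute)
    have "[l * g = (l mod m) * b] (mod m)"
      using b by (intro cong_mult) (auto simp: cong_def)
    then show ?thesis
      using l m(2) by (intro exI[of _ "l mod m"]) auto
  qed
  then show "\<exists>b\<in>D. \<forall>n\<in>D. \<exists>k<m. [n = k * b] (mod m)"
    using b(1) by blast
qed

section \<open>Polynomials in \<open>a\<close> form a linear subspace\<close>

context assoc_algebra
begin

text \<open>Allows polynomials of different degrees to be evaluated over one common index
  range.\<close>

lemma alg_eval_eq_sum:
  assumes "degree p \<le> n"
  shows "alg_eval scale p a = (\<Sum>i\<le>n. coeff p i *s a ^ i)"
  unfolding alg_eval_def
  by (rule sum.mono_neutral_left) (use assms in \<open>auto simp: coeff_eq_0\<close>)

lemma alg_eval_add: "alg_eval scale (p + q) a = alg_eval scale p a + alg_eval scale q a"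
proof -
  let ?n = "max (degree p) (degree q)"
  have "degree (p + q) \<le> ?n"
    by (rule degree_add_le_max)
  then show ?thesis
    by (simp add: alg_eval_eq_sum[of _ ?n] scale_left_distrib sum.distrib)
qed

lemma alg_eval_smult: "alg_eval scale (smult c p) a = c *s alg_eval scale p a"
  by (simp add: alg_eval_eq_sum[of _ "degree p"] scale_sum_right)

lemma alg_eval_monom: "alg_eval scale (monom c n) a = c *s a ^ n"
proof -
  have "alg_eval scale (monom c n) a = (\<Sum>i\<le>n. (if i = n then c *s a ^ n else 0))"
    unfolding alg_eval_eq_sum[OF degree_monom_le] by (rule sum.cong) auto
  then show ?thesis
    by simp
qed

lemma poly_subalgebra_add:
  "x \<in> poly_subalgebra scale a \<Longrightarrow> y \<in> poly_subalgebra scale a \<Longrightarrow> x + y \<in> poly_subalgebra scale a"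
  unfolding poly_subalgebra_def by (auto simp: alg_eval_add[symmetric])

lemma poly_subalgebra_scale:
  "x \<in> poly_subalgebra scale a \<Longrightarrow> c *s x \<in> poly_subalgebra scale a"
  unfolding poly_subalgebra_def by (auto simp: alg_eval_smult[symmetric])

lemma power_in_poly_subalgebra: "a ^ n \<in> poly_subalgebra scale a"
  unfolding poly_subalgebra_def by (rule range_eqI[of _ _ "monom 1 n"]) (simp add: alg_eval_monom)

lemma zero_in_poly_subalgebra: "0 \<in> poly_subalgebra scale a"
  using poly_subalgebra_scale[OF power_in_poly_subalgebra, of 0] by simp

end

section \<open>Algebras with a degree in the natural numbers\<close>

text \<open>The value of \<open>deg\<close> at \<open>0\<close> is irrelevant.\<close>

locale degree_algebra = assoc_algebra scale
  for scale :: "'k::field \<Rightarrow> 's::ring_1 \<Rightarrow> 's" (infixr \<open>*s\<close> 75) +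
  fixes C :: "'s set" and deg :: "'s \<Rightarrow> nat"
  assumes subalgebra: "subalgebra scale C"
    and mult_nonzero: "\<lbrakk>x \<in> C; y \<in> C; x \<noteq> 0; y \<noteq> 0\<rbrakk> \<Longrightarrow> x * y \<noteq> 0"
    and deg_mult: "\<lbrakk>x \<in> C; y \<in> C; x \<noteq> 0; y \<noteq> 0\<rbrakk> \<Longrightarrow> deg (x * y) = deg x + deg y"
    and deg_add_le: "\<lbrakk>x \<in> C; y \<in> C; x \<noteq> 0; y \<noteq> 0; x + y \<noteq> 0\<rbrakk> \<Longrightarrow> deg (x + y) \<le> max (deg x) (deg y)"
    and deg_dependent: "\<lbrakk>x \<in> C; y \<in> C; x \<noteq> 0; y \<noteq> 0; deg x = deg y\<rbrakk> \<Longrightarrow>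
      \<exists>\<alpha> \<beta>. (\<alpha> \<noteq> 0 \<or> \<beta> \<noteq> 0) \<and> (\<alpha> *s x + \<beta> *s y = 0 \<or> deg (\<alpha> *s x + \<beta> *s y) < deg x)"
begin

lemma one_closed: "1 \<in> C"
  and add_closed: "x \<in> C \<Longrightarrow> y \<in> C \<Longrightarrow> x + y \<in> C"
  and mult_closed: "x \<in> C \<Longrightarrow> y \<in> C \<Longrightarrow> x * y \<in> C"
  and scale_closed: "x \<in> C \<Longrightarrow> c *s x \<in> C"
  using subalgebra by (auto simp: subalgebra_def)

lemma zero_closed: "0 \<in> C"
  using scale_closed[OF one_closed, of 0] by simp

lemma uminus_closed: "x \<in> C \<Longrightarrow> - x \<in> C"
  using scale_closed[of x "- 1"] by simp

lemma diff_closed: "x \<in> C \<Longrightarrow> y \<in> C \<Longrightarrow> x - y \<in> C"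
  using add_closed[of x "- y"] uminus_closed by simp

lemma power_closed: "x \<in> C \<Longrightarrow> x ^ n \<in> C"
  by (induction n) (auto intro: one_closed mult_closed)

lemma sum_closed: "(\<And>i. i \<in> I \<Longrightarrow> f i \<in> C) \<Longrightarrow> (\<Sum>i\<in>I. f i) \<in> C"
  by (induction I rule: infinite_finite_induct) (auto intro: zero_closed add_closed)

lemma deg_one: "deg 1 = 0"
  using deg_mult[of 1 1] one_closed by simp

lemma power_nonzero: "x \<in> C \<Longrightarrow> x \<noteq> 0 \<Longrightarrow> x ^ n \<noteq> 0"
  by (induction n) (simp_all add: mult_nonzero power_closed)

lemma deg_power: "x \<in> C \<Longrightarrow> x \<noteq> 0 \<Longrightarrow> deg (x ^ n) = n * deg x"
  by (induction n) (auto simp: deg_one deg_mult power_closed power_nonzero)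

text \<open>A nonzero scalar is invertible in \<open>C\<close>. The degrees of \<open>c *s 1\<close>
  and its inverse are natural numbers with sum \<open>deg 1 = 0\<close>, so both vanish.\<close>

lemma deg_scale:
  assumes "x \<in> C" "x \<noteq> 0" "c \<noteq> 0"
  shows "deg (c *s x) = deg x"
proof -
  have inv: "(c *s 1) * (inverse c *s 1) = 1"
    using assms by (simp add: scale_mult_left scale_mult_right)
  have "deg (c *s 1) + deg (inverse c *s 1) = deg ((c *s 1) * (inverse c *s 1))"
    using assms by (intro deg_mult[symmetric] scale_closed one_closed) auto
  then have "deg (c *s 1) = 0"
    by (simp add: inv deg_one)
  moreover have "deg ((c *s 1) * x) = deg (c *s 1) + deg x"
    using assms by (intro deg_mult scale_closed one_closed) auto
  ultimately show ?thesis
    by (simp add: scale_mult_left)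
qed

lemma deg_uminus: "x \<in> C \<Longrightarrow> deg (- x) = deg x"
  using deg_scale[of x "- 1"] by (cases "x = 0") auto

lemma deg_diff_le: "\<lbrakk>x \<in> C; y \<in> C; x \<noteq> 0; y \<noteq> 0; x - y \<noteq> 0\<rbrakk> \<Longrightarrow> deg (x - y) \<le> max (deg x) (deg y)"
  using deg_add_le[of x "- y"] by (simp add: uminus_closed deg_uminus)

text \<open>The lower bound on the degree comes from writing \<open>y\<close> as
  \<open>(x + y) - x\<close>. If the sum were \<open>0\<close>, then \<open>y = - x\<close> would
  have the degree of \<open>x\<close>.\<close>

lemma deg_add_less:
  assumes "x \<in> C" "y \<in> C" "x \<noteq> 0" "y \<noteq> 0" "deg x < deg y"
  shows "x + y \<noteq> 0 \<and> deg (x + y) = deg y"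
proof -
  have nz: "x + y \<noteq> 0"
    using assms deg_uminus[of x] by (metis add_eq_0_iff nat_neq_iff)
  have "deg ((x + y) - x) \<le> max (deg (x + y)) (deg x)"
    using assms nz by (intro deg_diff_le add_closed) auto
  moreover have "deg (x + y) \<le> max (deg x) (deg y)"
    using assms nz by (intro deg_add_le)
  ultimately show ?thesis
    using assms nz by auto
qed

lemma deg_add_distinct:
  assumes "x \<in> C" "y \<in> C" "x \<noteq> 0" "y \<noteq> 0" "deg x \<noteq> deg y"
  shows "x + y \<noteq> 0" and "deg (x + y) \<in> {deg x, deg y}"
  using deg_add_less[of x y] deg_add_less[of y x] assms
  by (auto simp: add.commute neq_iff)

text \<open>Knowing only that the degree of a partial sum is that of one of its terms suffices for
  the induction: it then differs from the degree of the next term.\<close>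

lemma sum_distinct_deg:
  assumes "finite I" "I \<noteq> {}" "\<And>i. i \<in> I \<Longrightarrow> f i \<in> C" "\<And>i. i \<in> I \<Longrightarrow> f i \<noteq> 0"
    and "inj_on (\<lambda>i. deg (f i)) I"
  shows "(\<Sum>i\<in>I. f i) \<noteq> 0 \<and> deg (\<Sum>i\<in>I. f i) \<in> (\<lambda>i. deg (f i)) ` I"
  using assms
proof (induction I rule: finite_ne_induct)
  case (insert i I)
  let ?s = "\<Sum>i\<in>I. f i"
  have IH: "?s \<noteq> 0 \<and> deg ?s \<in> (\<lambda>i. deg (f i)) ` I"
    using insert by auto
  have "?s \<in> C"
    using insert.prems by (intro sum_closed) auto
  moreover have "deg (f i) \<noteq> deg ?s"
    using IH insert.prems(3) insert.hyps(3) by auto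
  ultimately have "f i + ?s \<noteq> 0" "deg (f i + ?s) \<in> {deg (f i), deg ?s}"
    using deg_add_distinct[of "f i" ?s] IH insert.prems by auto
  then show ?case
    using IH insert.hyps by auto
qed auto

text \<open>In the combination given by \<open>deg_dependent\<close>, the coefficient of
  \<open>x\<close> is nonzero: otherwise a nonzero multiple of \<open>y\<close> would have degree
  less than \<open>deg y\<close>. Dividing by this coefficient gives \<open>c\<close>.\<close>

lemma cancel_leading_term:
  assumes "x \<in> C" "y \<in> C" "x \<noteq> 0" "y \<noteq> 0" "deg x = deg y"
  obtains c where "x - c *s y = 0 \<or> deg (x - c *s y) < deg x"
proof -
  obtain \<alpha> \<beta> where nz: "\<alpha> \<noteq> 0 \<or> \<beta> \<noteq> 0"
    and less: "\<alpha> *s x + \<beta> *s y = 0 \<or> deg (\<alpha> *s x + \<beta> *s y) < deg x"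
    using deg_dependent assms by metis
  have \<alpha>: "\<alpha> \<noteq> 0"
  proof
    assume "\<alpha> = 0"
    then show False
      using nz less deg_scale[of y \<beta>] assms by auto
  qed
  let ?z = "x - (- \<beta> / \<alpha>) *s y"
  have z: "\<alpha> *s ?z = \<alpha> *s x + \<beta> *s y"
    using \<alpha> by (simp add: scale_right_distrib scale_right_diff_distrib)
  have "?z \<in> C"
    using assms by (intro diff_closed scale_closed)
  then have "?z = 0 \<or> deg ?z < deg x"
    using less \<alpha> deg_scale[of ?z \<alpha>] z scale_eq_0_iff by metis
  then show thesis
    by (rule that)
qed

text \<open>Leading terms are cancelled against elements of \<open>W\<close> until the degree falls
  below \<open>N\<close>. This serves both commutativity, where \<open>W\<close> consists of the
  elements commuting with \<open>y\<close>, and spanning, where \<open>W\<close> is the span of the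
  basis and \<open>N = 0\<close>.\<close>

lemma reduce_modulo_subspace:
  assumes W: "W \<subseteq> C" "0 \<in> W" "\<And>u v. u \<in> W \<Longrightarrow> v \<in> W \<Longrightarrow> u + v \<in> W" "\<And>c u. u \<in> W \<Longrightarrow> c *s u \<in> W"
    and leading: "\<And>z. \<lbrakk>z \<in> C; z \<noteq> 0; deg z \<ge> N\<rbrakk> \<Longrightarrow> \<exists>w\<in>W. w \<noteq> 0 \<and> deg w = deg z"
    and x: "x \<in> C"
  shows "\<exists>w\<in>W. x - w = 0 \<or> deg (x - w) < N"
  using x
proof (induction "deg x" arbitrary: x rule: less_induct)
  case less
  show ?case
  proof (cases "x = 0 \<or> deg x < N")
    case True
    then show ?thesis
      using W(2) by (intro bexI[of _ 0]) auto
  next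
    case False
    then obtain u where u: "u \<in> W" "u \<noteq> 0" "deg u = deg x"
      using leading[of x] less.prems by auto
    then obtain c where c: "x - c *s u = 0 \<or> deg (x - c *s u) < deg x"
      using cancel_leading_term[of x u] less.prems W(1) False by auto
    have "x - c *s u \<in> C"
      using u W(1) less.prems by (auto intro: diff_closed scale_closed)
    then obtain w where w: "w \<in> W" "x - c *s u - w = 0 \<or> deg (x - c *s u - w) < N"
      using c less.hyps[of "x - c *s u"] W(2) by force
    then show ?thesis
      using u W(3,4) by (intro bexI[of _ "c *s u + w"]) (auto simp: algebra_simps)
  qed
qed

end

section \<open>Algebras with a central element \<open>a\<close> of positive degree\<close>

locale degree_algebra_central = degree_algebra scale C deg
  for scale :: "'k::field \<Rightarrow> 's::ring_1 \<Rightarrow> 's" (infixr \<open>*s\<close> 75) and C deg +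
  fixes a :: 's
  assumes a_closed: "a \<in> C" and a_nonzero: "a \<noteq> 0" and deg_a_pos: "deg a > 0"
    and a_central: "x \<in> C \<Longrightarrow> x * a = a * x"
begin

lemma power_a_central: "x \<in> C \<Longrightarrow> x * a ^ n = a ^ n * x"
  by (rule power_commuting_commutes[OF a_central[symmetric], symmetric])

definition degrees :: "nat set" where
  "degrees = deg ` (C - {0})"

lemma degrees_add: "x \<in> degrees \<Longrightarrow> y \<in> degrees \<Longrightarrow> x + y \<in> degrees"
  by (auto simp: degrees_def deg_mult[symmetric] mult_nonzero mult_closed)

lemma deg_a_in_degrees: "deg a \<in> degrees"
  using a_closed a_nonzero by (auto simp: degrees_def)

lemmas degree_residues = additive_nat_set_residues[OF degrees_add deg_a_in_degrees deg_a_pos]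

lemma poly_subalgebra_closed: "r \<in> poly_subalgebra scale a \<Longrightarrow> r \<in> C"
  by (auto simp: poly_subalgebra_def alg_eval_def intro!: sum_closed scale_closed power_closed a_closed)

text \<open>The terms with nonzero coefficient have degrees \<open>i * deg a\<close>, which are
  pairwise distinct, so \<open>deg r\<close> is one of them.\<close>

lemma deg_poly_subalgebra:
  assumes "r \<in> poly_subalgebra scale a" "r \<noteq> 0"
  shows "deg a dvd deg r"
proof -
  obtain p where p: "r = alg_eval scale p a"
    using assms(1) by (auto simp: poly_subalgebra_def)
  let ?I = "{i. i \<le> degree p \<and> coeff p i \<noteq> 0}"
  have deg: "deg (coeff p i *s a ^ i) = i * deg a" if "i \<in> ?I" for i
    using that by (simp add: deg_scale deg_power power_closed power_nonzero a_closed a_nonzero)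
  have r: "r = (\<Sum>i\<in>?I. coeff p i *s a ^ i)"
    unfolding p alg_eval_def by (rule sum.mono_neutral_right) auto
  have ne: "?I \<noteq> {}"
    using assms(2) r by (metis (no_types, lifting) sum.empty)
  have inj: "inj_on (\<lambda>i. deg (coeff p i *s a ^ i)) ?I"
    using deg_a_pos by (intro inj_onI) (simp add: deg)
  have "deg r \<in> (\<lambda>i. deg (coeff p i *s a ^ i)) ` ?I"
    unfolding r
    by (rule conjunct2[OF sum_distinct_deg[OF _ ne _ _ inj]])
      (auto intro: scale_closed power_closed a_closed simp: power_nonzero a_closed a_nonzero)
  then show ?thesis
    using deg by auto
qed

text \<open>A nonzero commutator of \<open>x\<close> and \<open>y\<close>, multiplied by
  \<open>a ^ j\<close>, has degree at least \<open>j\<close>. Reducing \<open>a ^ j * x\<close>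
  modulo the elements that commute with \<open>y\<close> bounds the same degree independently of
  \<open>j\<close>.\<close>

lemma commute_if_commute_generator:
  assumes b: "b \<in> C" "b \<noteq> 0" and gen: "\<forall>n\<in>degrees. \<exists>k<deg a. [n = k * deg b] (mod deg a)"
    and y: "y \<in> C" "b * y = y * b" and x: "x \<in> C"
  shows "x * y = y * x"
proof (rule ccontr)
  assume "x * y \<noteq> y * x"
  define z where "z = x * y - y * x"
  have z: "z \<in> C" "z \<noteq> 0"
    using \<open>x * y \<noteq> y * x\<close> x y by (auto simp: z_def intro: diff_closed mult_closed)
  have y0: "y \<noteq> 0"
    using \<open>x * y \<noteq> y * x\<close> by auto
  define W where "W = {w \<in> C. w * y = y * w}"
  \<comment> \<open>The exponents \<open>k\<close> in \<open>gen\<close> are less than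
    \<open>deg a\<close>, so a degree of at least \<open>N\<close> exceeds or equals
    \<open>k * deg b\<close>. The difference is then a nonnegative multiple of \<open>deg a\<close>,
    supplied by a power of \<open>a\<close>.\<close>
  define N where "N = deg a * deg b"
  have mon: "a ^ i * b ^ k \<in> W" for i k
  proof -
    have "a ^ i * b ^ k * y = a ^ i * (y * b ^ k)"
      using power_commuting_commutes[OF y(2), of k] by (simp add: mult.assoc)
    also have "\<dots> = y * (a ^ i * b ^ k)"
      using power_a_central[OF y(1), of i] by (simp add: mult.assoc[symmetric])
    finally show ?thesis
      using b a_closed by (auto simp: W_def intro: mult_closed power_closed)
  qed
  have lead: "\<exists>w\<in>W. w \<noteq> 0 \<and> deg w = deg u" if u: "u \<in> C" "u \<noteq> 0" "deg u \<ge> N" for u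
  proof -
    have "deg u \<in> degrees"
      using u by (auto simp: degrees_def)
    then obtain k where k: "k < deg a" "[deg u = k * deg b] (mod deg a)"
      using gen by auto
    have "k * deg b \<le> deg u"
      using k(1) u(3) unfolding N_def by (meson le_trans less_imp_le mult_le_mono1)
    then obtain i where i: "deg u = k * deg b + i * deg a"
      using k(2) by (metis cong_sym cong_le_nat mult.commute add.commute)
    have nz: "a ^ i \<noteq> 0" "b ^ k \<noteq> 0" and cl: "a ^ i \<in> C" "b ^ k \<in> C"
      using b a_closed a_nonzero by (simp_all add: power_nonzero power_closed)
    have "deg (a ^ i * b ^ k) = deg u"
      using b i a_closed a_nonzero by (simp add: deg_mult[OF cl nz] deg_power)
    then show ?thesis
      using mon mult_nonzero[OF cl nz] by blast
  qed
  \<comment> \<open>The commutator of \<open>y\<close> with a remainder of degree less than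
    \<open>N\<close> has degree less than \<open>N + deg y\<close>, if it is nonzero.\<close>
  define j where "j = N + deg y"
  have ajx: "a ^ j * x \<in> C"
    using a_closed x by (intro mult_closed power_closed)
  have W: "W \<subseteq> C" "0 \<in> W" "\<And>u v. u \<in> W \<Longrightarrow> v \<in> W \<Longrightarrow> u + v \<in> W"
    "\<And>c u. u \<in> W \<Longrightarrow> c *s u \<in> W"
    by (auto simp: W_def zero_closed add_closed scale_closed scale_mult_left scale_mult_right algebra_simps)
  have "\<exists>w\<in>W. a ^ j * x - w = 0 \<or> deg (a ^ j * x - w) < N"
    by (rule reduce_modulo_subspace) fact+
  then obtain w where w: "w \<in> W" "a ^ j * x - w = 0 \<or> deg (a ^ j * x - w) < N"
    by blast
  define v where "v = a ^ j * x - w"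
  have v: "v \<in> C" "v = 0 \<or> deg v < N"
    using w W(1) ajx by (auto simp: v_def intro: diff_closed)
  have wy: "w * y = y * w"
    using w by (simp add: W_def)
  have "y * (a ^ j * x) = a ^ j * (y * x)"
    using power_a_central[OF y(1), of j] by (metis mult.assoc)
  \<comment> \<open>As \<open>w\<close> commutes with \<open>y\<close>, only the remainder
    \<open>v\<close> contributes to the commutator.\<close>
  then have eq: "a ^ j * z = v * y - y * v"
    by (simp add: z_def v_def right_diff_distrib left_diff_distrib wy mult.assoc)
  have aj: "a ^ j \<in> C" "a ^ j \<noteq> 0"
    using a_closed a_nonzero by (simp_all add: power_nonzero power_closed)
  have nz: "v * y - y * v \<noteq> 0"
    using mult_nonzero[OF aj(1) z(1) aj(2) z(2)] eq by simp
  then have v0: "v \<noteq> 0"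
    by auto
  have "j \<le> j * deg a"
    using deg_a_pos by simp
  also have "\<dots> \<le> deg (a ^ j * z)"
    using a_closed a_nonzero by (simp add: deg_mult[OF aj(1) z(1) aj(2) z(2)] deg_power)
  also have "\<dots> \<le> max (deg (v * y)) (deg (y * v))"
    unfolding eq using v v0 y y0 nz
    by (intro deg_diff_le mult_closed mult_nonzero)
  also have "\<dots> < N + deg y"
    using v v0 y y0 by (simp add: deg_mult)
  finally show False
    by (simp add: j_def)
qed

lemma commutative:
  assumes "x \<in> C" "y \<in> C"
  shows "x * y = y * x"
proof -
  obtain b where b: "b \<in> C" "b \<noteq> 0" "\<forall>n\<in>degrees. \<exists>k<deg a. [n = k * deg b] (mod deg a)"
    using degree_residues(2) unfolding degrees_def by blast
  \<comment> \<open>\<open>b\<close> commutes with itself, so it can take the role of the fixed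
    element \<open>y\<close> of the lemma.\<close>
  have "y * b = b * y"
    using commute_if_commute_generator[OF b b(1) refl assms(2)] .
  then show ?thesis
    using commute_if_commute_generator[OF b assms(2) _ assms(1)] by simp
qed

text \<open>The basis has one element for each residue of degrees modulo \<open>deg a\<close>, of
  least degree in its class. Minimality gives spanning, and distinct residues give
  independence.\<close>

lemma finite_module_basis_exists:
  "\<exists>E. finite_module_basis (poly_subalgebra scale a) C E \<and> card E dvd deg a"
proof -
  let ?R = "poly_subalgebra scale a"
  define H where "H = (\<lambda>n. n mod deg a) ` degrees"
  have "\<exists>e. (e \<in> C \<and> e \<noteq> 0 \<and> deg e mod deg a = h) \<and>
      (\<forall>x. x \<in> C \<and> x \<noteq> 0 \<and> deg x mod deg a = h \<longrightarrow> deg e \<le> deg x)" if h: "h \<in> H" for h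
  proof -
    obtain x where "x \<in> C \<and> x \<noteq> 0 \<and> deg x mod deg a = h"
      using h by (auto simp: H_def degrees_def)
    then show ?thesis
      using ex_has_least_nat[of "\<lambda>x. x \<in> C \<and> x \<noteq> 0 \<and> deg x mod deg a = h" x deg] by blast
  qed
  then obtain e where e: "\<And>h. h \<in> H \<Longrightarrow> e h \<in> C" "\<And>h. h \<in> H \<Longrightarrow> e h \<noteq> 0"
      "\<And>h. h \<in> H \<Longrightarrow> deg (e h) mod deg a = h"
    and least: "\<And>h x. \<lbrakk>h \<in> H; x \<in> C; x \<noteq> 0; deg x mod deg a = h\<rbrakk> \<Longrightarrow> deg (e h) \<le> deg x"
    by metis
  define E where "E = e ` H"
  have "H \<subseteq> {..<deg a}"
    using deg_a_pos by (auto simp: H_def)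
  then have "finite H"
    using finite_subset by blast
  then have finE: "finite E"
    by (simp add: E_def)
  have EC: "E \<subseteq> C" and E0: "\<And>x. x \<in> E \<Longrightarrow> x \<noteq> 0"
    using e by (auto simp: E_def)
  have "inj_on e H"
    using e(3) by (metis inj_onI)
  then have cardE: "card E dvd deg a"
    using degree_residues(1) by (simp add: E_def card_image H_def)
  have injE: "inj_on (\<lambda>x. deg x mod deg a) E"
    using e(3) by (auto simp: E_def inj_on_def)
  \<comment> \<open>The span of \<open>E\<close> over polynomials in \<open>a\<close>, viewed as a
    subspace over the field for the reduction lemma.\<close>
  define W where "W = {\<Sum>x\<in>E. r x * x | r. \<forall>x\<in>E. r x \<in> ?R}"
  have WI: "(\<Sum>x\<in>E. r x * x) \<in> W" if "\<And>x. x \<in> E \<Longrightarrow> r x \<in> ?R" for r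
    using that by (auto simp: W_def)
  have W_C: "W \<subseteq> C"
    using EC poly_subalgebra_closed by (auto simp: W_def intro!: sum_closed mult_closed)
  have W_0: "0 \<in> W"
    using WI[of "\<lambda>_. 0"] zero_in_poly_subalgebra by simp
  have W_add: "u + v \<in> W" if uv: "u \<in> W" "v \<in> W" for u v
  proof -
    obtain r s where "u = (\<Sum>x\<in>E. r x * x)" "\<forall>x\<in>E. r x \<in> ?R" "v = (\<Sum>x\<in>E. s x * x)" "\<forall>x\<in>E. s x \<in> ?R"
      using uv by (auto simp: W_def)
    then show ?thesis
      using WI[of "\<lambda>x. r x + s x"] by (simp add: poly_subalgebra_add sum.distrib distrib_right)
  qed
  have W_scale: "c *s u \<in> W" if u: "u \<in> W" for c u
  proof -
    obtain r where "u = (\<Sum>x\<in>E. r x * x)" "\<forall>x\<in>E. r x \<in> ?R"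
      using u by (auto simp: W_def)
    then show ?thesis
      using WI[of "\<lambda>x. c *s r x"] by (simp add: poly_subalgebra_scale scale_sum_right scale_mult_left)
  qed
  have lead: "\<exists>w\<in>W. w \<noteq> 0 \<and> deg w = deg z" if z: "z \<in> C" "z \<noteq> 0" "deg z \<ge> 0" for z
  proof -
    define h where "h = deg z mod deg a"
    have h: "h \<in> H"
      using z by (auto simp: h_def H_def degrees_def)
    have "deg (e h) \<le> deg z" "[deg z = deg (e h)] (mod deg a)"
      using least[OF h z(1,2)] e(3)[OF h] by (auto simp: h_def cong_def)
    \<comment> \<open>By minimality of \<open>deg (e h)\<close> the exponent \<open>i\<close> is a
      natural number, so \<open>a ^ i * e h\<close> matches the degree of \<open>z\<close>.\<close>
    then obtain i where i: "deg z = deg (e h) + i * deg a"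
      by (metis cong_sym cong_le_nat mult.commute add.commute)
    have aj: "a ^ i \<in> C" "a ^ i \<noteq> 0"
      using a_closed a_nonzero by (simp_all add: power_nonzero power_closed)
    have "(\<Sum>x\<in>E. (if x = e h then a ^ i else 0) * x) = (\<Sum>x\<in>E. if x = e h then a ^ i * e h else 0)"
      by (rule sum.cong) auto
    also have "\<dots> = a ^ i * e h"
      using h finE by (simp add: E_def)
    finally have "a ^ i * e h \<in> W"
      using WI[of "\<lambda>x. if x = e h then a ^ i else 0"]
      by (simp add: power_in_poly_subalgebra zero_in_poly_subalgebra)
    moreover have "a ^ i * e h \<noteq> 0" "deg (a ^ i * e h) = deg z"
      using e[OF h] aj i a_closed a_nonzero by (auto simp: mult_nonzero deg_mult deg_power)
    ultimately show ?thesis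
      by blast
  qed
  have span: "\<exists>r. (\<forall>e\<in>E. r e \<in> ?R) \<and> x = (\<Sum>e\<in>E. r e * e)" if x: "x \<in> C" for x
  proof -
    \<comment> \<open>With \<open>N = 0\<close> the second alternative is impossible, so
      \<open>x\<close> itself lies in \<open>W\<close>.\<close>
    have "\<exists>w\<in>W. x - w = 0 \<or> deg (x - w) < 0"
      by (rule reduce_modulo_subspace) fact+
    then show ?thesis
      by (auto simp: W_def)
  qed
  have indep: "r x = 0" if r: "\<forall>x\<in>E. r x \<in> ?R" "(\<Sum>x\<in>E. r x * x) = 0" and x: "x \<in> E" for r x
  proof (rule ccontr)
    assume "r x \<noteq> 0"
    define I where "I = {x \<in> E. r x \<noteq> 0}"
    have I: "finite I" "I \<noteq> {}"
      using finE x \<open>r x \<noteq> 0\<close> by (auto simp: I_def)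
    have rC: "r u \<in> C" "u \<in> C" "r u \<noteq> 0" "u \<noteq> 0" if "u \<in> I" for u
      using that r EC E0 by (auto simp: I_def intro: poly_subalgebra_closed)
    \<comment> \<open>\<open>deg (r u)\<close> is a multiple of \<open>deg a\<close>, so the
      coefficient does not change the residue, and residues separate the elements of
      \<open>E\<close>.\<close>
    have "deg (r u * u) mod deg a = deg u mod deg a" if "u \<in> I" for u
      using that deg_poly_subalgebra[of "r u"] r(1) rC[OF that] by (auto simp: I_def deg_mult)
    then have "inj_on (\<lambda>u. deg (r u * u)) I"
      using injE unfolding inj_on_def I_def by (metis (mono_tags, lifting) mem_Collect_eq)
    then have "(\<Sum>u\<in>I. r u * u) \<noteq> 0"
      using rC by (intro conjunct1[OF sum_distinct_deg[OF I]]) (auto intro: mult_closed simp: mult_nonzero)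
    moreover have "(\<Sum>u\<in>I. r u * u) = (\<Sum>x\<in>E. r x * x)"
      unfolding I_def using finE by (intro sum.mono_neutral_left) auto
    ultimately show False
      using r(2) by simp
  qed
  have "finite_module_basis ?R C E"
    unfolding finite_module_basis_def using finE EC span indep by blast
  then show ?thesis
    using cardE by blast
qed

end

section \<open>The centralizer as an algebra with degree\<close>

theorem theorem2p8:
  fixes scale :: "'k::field \<Rightarrow> 's::ring_1 \<Rightarrow> 's"
    and \<chi> :: "'s \<Rightarrow> int extended"
    and a :: 's and m :: int
  assumes "assoc_algebra scale"
    and "pseudo_degree \<chi>"
    and "\<chi> a = Fin m" and "m > 0"
    and "condition_D 1 scale \<chi> (centralizer a)"
  shows "(\<exists>E. finite_module_basis (poly_subalgebra scale a) (centralizer a) E \<and> int (card E) dvd m)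
    \<and> (\<forall>x\<in>centralizer a. \<forall>y\<in>centralizer a. x * y = y * x)"
proof -
  let ?C = "centralizer a"
  interpret assoc_algebra scale
    by fact
  \<comment> \<open>On nonzero elements of the centralizer \<open>\<chi>\<close> is a nonnegative
    integer, so passing to natural numbers loses nothing there. The value at \<open>0\<close> is a
    default.\<close>
  define deg where "deg x = (case \<chi> x of Fin n \<Rightarrow> nat n | _ \<Rightarrow> 0)" for x
  have \<chi>_0: "\<chi> x = Minf \<longleftrightarrow> x = 0" and \<chi>_mult: "\<chi> (x * y) = \<chi> x + \<chi> y"
    and \<chi>_add: "\<chi> (x + y) \<le> max (\<chi> x) (\<chi> y)" and \<chi>_Pinf: "\<chi> x \<noteq> Pinf" for x y
    using assms(2) by (auto simp: pseudo_degree_def)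
  have sub: "subalgebra scale ?C"
    by (rule subalgebra_centralizer)
  have nonneg: "\<chi> x \<ge> Fin 0" if "x \<in> ?C" "x \<noteq> 0" for x
    using assms(5) that by (auto simp: condition_D_def)
  have \<chi>_deg: "\<chi> x = Fin (int (deg x))" if "x \<in> ?C" "x \<noteq> 0" for x
    using nonneg[OF that] \<chi>_Pinf[of x] \<chi>_0[of x] that by (cases "\<chi> x") (auto simp: deg_def)
  have mult_nz: "x * y \<noteq> 0" if "x \<noteq> 0" "y \<noteq> 0" for x y :: 's
  proof -
    have "\<chi> (x * y) \<noteq> Minf"
      using \<chi>_mult[of x y] \<chi>_0[of x] \<chi>_0[of y] \<chi>_Pinf[of x] \<chi>_Pinf[of y] that
      by (cases "\<chi> x"; cases "\<chi> y") auto
    then show ?thesis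
      using \<chi>_0 by blast
  qed
  have closed: "x + y \<in> ?C" "x * y \<in> ?C" "scale c x \<in> ?C" if "x \<in> ?C" "y \<in> ?C" for x y c
    using sub that by (auto simp: subalgebra_def)
  interpret D: degree_algebra_central scale ?C deg a
  proof unfold_locales
    show "subalgebra scale ?C"
      by (rule sub)
  next
    fix x y assume xy: "x \<in> ?C" "y \<in> ?C" "x \<noteq> 0" "y \<noteq> 0"
    show "x * y \<noteq> 0"
      using mult_nz xy by blast
    show "deg (x * y) = deg x + deg y"
      using \<chi>_mult[of x y] \<chi>_deg[of "x * y"] \<chi>_deg[of x] \<chi>_deg[of y] xy mult_nz[of x y] closed(2)[of x y]
      by auto
    show "deg (x + y) \<le> max (deg x) (deg y)" if "x + y \<noteq> 0"
      using \<chi>_add[of x y] \<chi>_deg[of "x + y"] \<chi>_deg[of x] \<chi>_deg[of y] xy that closed(1)[of x y]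
      by (auto simp: max_def split: if_splits)
    assume deg: "deg x = deg y"
    \<comment> \<open>Condition D(1) speaks of a family indexed by 1 and 2; here it is
      \<open>x\<close>, \<open>y\<close>.\<close>
    define b where "b i = (if i = 1 then x else y)" for i :: nat
    have "\<forall>i\<in>{1..1 + 1}. b i \<in> ?C \<and> \<chi> (b i) = Fin (int (deg x))"
      using xy \<chi>_deg deg by (auto simp: b_def)
    then have "\<exists>\<alpha> :: nat \<Rightarrow> 'k. (\<exists>i\<in>{1..1 + 1}. \<alpha> i \<noteq> 0) \<and>
        \<chi> (\<Sum>i=1..1 + 1. scale (\<alpha> i) (b i)) < \<chi> (b 1)"
      using assms(5) unfolding condition_D_def by blast
    moreover have "{1..1 + 1::nat} = {1, 2}"
      by auto
    ultimately obtain \<alpha> :: "nat \<Rightarrow> 'k" where \<alpha>: "\<alpha> 1 \<noteq> 0 \<or> \<alpha> 2 \<noteq> 0"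
        "\<chi> (scale (\<alpha> 1) (b 1) + scale (\<alpha> 2) (b 2)) < \<chi> (b 1)"
      by (auto simp: numeral_2_eq_2)
    let ?z = "scale (\<alpha> 1) x + scale (\<alpha> 2) y"
    have z: "?z \<in> ?C"
      using xy by (intro closed(1) closed(3)[OF _ xy(1)])
    have "\<chi> ?z < Fin (int (deg x))"
      using \<alpha>(2) \<chi>_deg[of x] xy by (simp add: b_def)
    then have "?z = 0 \<or> deg ?z < deg x"
      using \<chi>_deg[OF z] by (cases "?z = 0") auto
    then show "\<exists>\<alpha> \<beta>. (\<alpha> \<noteq> 0 \<or> \<beta> \<noteq> 0) \<and> (scale \<alpha> x + scale \<beta> y = 0 \<or> deg (scale \<alpha> x + scale \<beta> y) < deg x)"
      using \<alpha>(1) by blast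
  next
    show "a \<noteq> 0"
      using assms(3) \<chi>_0 by (metis extended.distinct(3))
    show "deg a > 0"
      using assms(3,4) by (simp add: deg_def)
  \<comment> \<open>It remains that \<open>a\<close> lies in its own centralizer and is central
    there.\<close>
  qed (simp_all add: centralizer_def)
  have "m = int (deg a)"
    using assms(3,4) by (simp add: deg_def)
  then show ?thesis
    using D.finite_module_basis_exists D.commutative by (metis of_nat_dvd_iff)
qed

end
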